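(* Let $\mathcal{F}:\mathbb{R}^{n\times p}\to\mathbb{R}$ be differentiable. For any $X\in\mathbb{R}^{n\times p}$ with $X^{\mathsf T}X=I_p$ and any $\rho>0$, consider the curve $Y(\tau)=Y(\tau;X)$, $\tau\ge0$, given by $$W=-(I_n-XX^{\mathsf T})D_\rho,\quad J=J(\tau)=I_p+\tfrac{\tau^2}{4}W^{\mathsf T}W+\tfrac{\tau}{2}X^{\mathsf T}D_\rho,\quad Y(\tau)=(2X+\tau W)J(\tau)^{-1}-X,$$ where $$D_\rho=(I_n-(1-2\rho)XX^{\mathsf T})\nabla\mathcal{F}=G-X\big(2\rho\,G^{\mathsf T}X+(1-2\rho)X^{\mathsf T}G\big).$$ Then the following properties hold. (i) $Y(\tau)^{\mathsf T}Y(\tau)=I_p$. (ii) $Y'(0)=-D_\rho$ is a descent direction and $$\mathcal{F}'_\tau(Y(0)):=\frac{\partial\mathcal{F}(Y(\tau))}{\partial\tau}\Big|_{\tau=0}\le-\min\{\rho,1\}\|\nabla\mathcal{F}\|_F^2 .$$ (iii) For any $\tau>0$ and any $p\times p$ orthogonal matrix $Q_p$, $Y(\tau)Q_p\ne X$. (iv) $\mathrm{cond}(J)\le(5+\upsilon^2)/4$, where $\upsilon=\tau\|D_\rho\|_F$. In particular, if $p=n$, then $Y(\tau)=X(2J^{-1}-I_n)$ and $J=I_n+\frac{\tau}{2}X^{\mathsf T}D_\rho$; if $p=1$, the matrices $X,Y,G$ reduce to vectors $x,y,g$, respectively, and the update scheme becomes $$y(\tau)=\bigg(\frac{2+\tau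 x^{\mathsf T}g}{1+\frac{\tau^2}{4}(g^{\mathsf T}g-(x^{\mathsf T}g)^2)}-1\bigg)x-\frac{\tau}{1+\frac{\tau^2}{4}(g^{\mathsf T}g-(x^{\mathsf T}g)^2)}\,g .$$
   Context: Here $1\le p\le n$. $G=(\partial\mathcal{F}(X)/\partial X_{ij})$ is the Euclidean gradient of $\mathcal{F}$ at $X$, and $\nabla\mathcal{F}=G-XG^{\mathsf T}X$. $\|\cdot\|_F$ is the Frobenius norm. For a matrix $A$, $\mathrm{cond}(A)=\big(\lambda_{\max}(A^{\mathsf T}A)/\lambda_{\min}(A^{\mathsf T}A)\big)^{1/2}$, where $\lambda_{\max}$ and $\lambda_{\min}$ denote the maximal and minimal eigenvalues. The matrix $X^{\mathsf T}D_\rho$ is skew-symmetric, so $J(\tau)$ is invertible and the curve is well defined.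
   Formalization: Property (iii) is stated only when W ≠ 0, since if W = 0 (e.g. F constant, or p = n) some orthogonal Q_p gives Y(τ)Q_p = X; in (ii), −D_ρ is claimed to be a descent direction only when ∇F ≠ 0, since otherwise D_ρ = 0. *)

theory Defs
  imports "HOL-Analysis.Analysis"
begin

text \<open>
  An \<open>n \<times> p\<close> real matrix has type \<^typ>\<open>real^'p^'n\<close>. The library norm on this type is the Frobenius
  norm, so \<open>norm\<close> is used for it throughout.
\<close>

lemma norm_matrix_eq_frobenius:
  fixes A :: "real^'p^'n"
  shows "norm A = sqrt (\<Sum>i\<in>UNIV. \<Sum>j\<in>UNIV. (A $ i $ j)\<^sup>2)"
  by (simp add: norm_vec_def L2_set_def sum_nonneg)

definition eigenvalues :: "real^'m^'m \<Rightarrow> real set" where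
  "eigenvalues A = {l. \<exists>v. v \<noteq> 0 \<and> A *v v = l *\<^sub>R v}"

text \<open>
  \<open>Max\<close> and \<open>Min\<close> are meaningful here because a real symmetric matrix has a finite nonempty set
  of real eigenvalues.
\<close>

definition cond_number :: "real^'p^'n \<Rightarrow> real" where
  "cond_number A =
     sqrt (Max (eigenvalues (transpose A ** A)) / Min (eigenvalues (transpose A ** A)))"

text \<open>The \<open>(i, j)\<close> entry is the partial derivative of \<open>F\<close> at \<open>X\<close> with respect to \<open>X $ i $ j\<close>.\<close>

definition euclidean_gradient :: "(real^'p^'n \<Rightarrow> real) \<Rightarrow> real^'p^'n \<Rightarrow> real^'p^'n" where
  "euclidean_gradient F X = (\<chi> i j. deriv (\<lambda>t. F (X + t *\<^sub>R axis i (axis j 1))) 0)"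

definition stiefel_gradient :: "(real^'p^'n \<Rightarrow> real) \<Rightarrow> real^'p^'n \<Rightarrow> real^'p^'n" where
  "stiefel_gradient F X =
     euclidean_gradient F X - X ** transpose (euclidean_gradient F X) ** X"

definition descent_direction :: "(real^'p^'n \<Rightarrow> real) \<Rightarrow> real^'p^'n \<Rightarrow> real^'p^'n \<Rightarrow> bool" where
  "descent_direction F X E \<longleftrightarrow>
     (\<exists>d<0. ((\<lambda>t. F (X + t *\<^sub>R E)) has_real_derivative d) (at 0))"

definition D_mat :: "(real^'p^'n \<Rightarrow> real) \<Rightarrow> real \<Rightarrow> real^'p^'n \<Rightarrow> real^'p^'n" where
  "D_mat F \<rho> X = (mat 1 - (1 - 2 * \<rho>) *\<^sub>R (X ** transpose X)) ** stiefel_gradient F X"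

definition W_mat :: "(real^'p^'n \<Rightarrow> real) \<Rightarrow> real \<Rightarrow> real^'p^'n \<Rightarrow> real^'p^'n" where
  "W_mat F \<rho> X = - ((mat 1 - X ** transpose X) ** D_mat F \<rho> X)"

definition J_mat :: "(real^'p^'n \<Rightarrow> real) \<Rightarrow> real \<Rightarrow> real^'p^'n \<Rightarrow> real \<Rightarrow> real^'p^'p" where
  "J_mat F \<rho> X \<tau> =
     mat 1 + (\<tau>\<^sup>2 / 4) *\<^sub>R (transpose (W_mat F \<rho> X) ** W_mat F \<rho> X)
           + (\<tau> / 2) *\<^sub>R (transpose X ** D_mat F \<rho> X)"

text \<open>
  If \<^prop>\<open>W_mat F \<rho> X = 0\<close> (always so for \<open>p = n\<close>, and for instance at a stationary point), then
  \<open>J_mat\<close> is the identity plus a skew-symmetric matrix and the curve below is \<open>X\<close> times a Cayley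
  transform. It then stays in the orbit of \<open>X\<close> under right multiplication by orthogonal matrices,
  so a claim that it leaves this orbit requires \<^prop>\<open>W_mat F \<rho> X \<noteq> 0\<close>.
\<close>

definition Y_curve :: "(real^'p^'n \<Rightarrow> real) \<Rightarrow> real \<Rightarrow> real^'p^'n \<Rightarrow> real \<Rightarrow> real^'p^'n" where
  "Y_curve F \<rho> X \<tau> = (2 *\<^sub>R X + \<tau> *\<^sub>R W_mat F \<rho> X) ** matrix_inv (J_mat F \<rho> X \<tau>) - X"

end

theory Submission
  imports Defs
begin

text \<open>
  With \<open>K = transpose X ** D_mat F \<rho> X\<close>, which is skew-symmetric, the direction splits orthogonally
  as \<open>D = X ** K - W\<close>. The symmetric part of \<open>J\<close> is at least the identity, so \<open>J\<close> does not shrink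
  vectors, and it stretches them by at most \<open>1 + \<tau>\<^sup>2 / 4 * (norm W)\<^sup>2 + \<tau> / 2 * (norm K)\<close>;
  the condition bound then follows from \<open>k - k\<^sup>2 \<le> 1 / 4\<close> with \<open>k = \<tau> / 2 * (norm K)\<close>.
  Orthonormality of \<open>Y\<close> comes from \<open>V\<^sup>T V = 2 (J + J\<^sup>T)\<close> and \<open>V\<^sup>T X = 2 I\<close> for
  \<open>V = 2 X + \<tau> W\<close>. If \<open>Y Q = X\<close>, then \<open>V = X (I + Q\<^sup>T) J\<close>, and multiplying by \<open>X\<^sup>T\<close> gives
  \<open>(I + Q\<^sup>T) J = 2 I\<close>, hence \<open>W = 0\<close>.
\<close>

section \<open>Real matrices with the Frobenius inner product\<close>

text \<open>Cauchy-Schwarz in each row, then the root of the sum of squares over the rows.\<close>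

lemma norm_matrix_vector_mult_le:
  fixes A :: "real^'m^'n"
  shows "norm (A *v x) \<le> norm A * norm x"
proof -
  have "norm (A *v x) = L2_set (\<lambda>i. norm (A $ i \<bullet> x)) UNIV"
    by (simp add: norm_vec_def matrix_vector_mul_component)
  also have "\<dots> \<le> L2_set (\<lambda>i. norm (A $ i) * norm x) UNIV"
    by (intro L2_set_mono) (auto simp: Cauchy_Schwarz_ineq2)
  also have "\<dots> = norm A * norm x"
    by (simp add: L2_set_left_distrib norm_vec_def)
  finally show ?thesis .
qed

text \<open>One source for the linearity rules of the product in both arguments and for limits of
  products.\<close>

lemma bounded_bilinear_matrix_mult:
  "bounded_bilinear ((**) :: real^'m^'n \<Rightarrow> real^'k^'m \<Rightarrow> real^'k^'n)"
  unfolding bilinear_conv_bounded_bilinear[symmetric] bilinear_def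
  by (auto intro!: linearI
      simp: matrix_matrix_mult_def vec_eq_iff sum.distrib algebra_simps sum_distrib_left)

lemmas matrix_mult_bilinear_simps =
  bounded_bilinear.add_left[OF bounded_bilinear_matrix_mult]
  bounded_bilinear.add_right[OF bounded_bilinear_matrix_mult]
  bounded_bilinear.diff_left[OF bounded_bilinear_matrix_mult]
  bounded_bilinear.diff_right[OF bounded_bilinear_matrix_mult]
  bounded_bilinear.minus_left[OF bounded_bilinear_matrix_mult]
  bounded_bilinear.minus_right[OF bounded_bilinear_matrix_mult]
  bounded_bilinear.scaleR_left[OF bounded_bilinear_matrix_mult]
  bounded_bilinear.scaleR_right[OF bounded_bilinear_matrix_mult]
  bounded_bilinear.zero_left[OF bounded_bilinear_matrix_mult]
  bounded_bilinear.zero_right[OF bounded_bilinear_matrix_mult]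

lemmas tendsto_matrix_mult = bounded_bilinear.tendsto[OF bounded_bilinear_matrix_mult]

lemma transpose_linear_simps:
  fixes A B :: "real^'m^'n"
  shows "transpose (A + B) = transpose A + transpose B"
    and "transpose (A - B) = transpose A - transpose B"
    and "transpose (- A) = - transpose A"
    and "transpose (r *\<^sub>R A) = r *\<^sub>R transpose A"
    and "transpose (0 :: real^'m^'n) = 0"
  by (simp_all add: transpose_def vec_eq_iff)

text \<open>Left multiplication by \<open>transpose A\<close> is the adjoint of left multiplication
  by \<open>A\<close>. This stands in for the usual trace manipulations.\<close>

lemma inner_matrix_mult_left:
  fixes A :: "real^'m^'n"
  shows "(A ** B) \<bullet> C = B \<bullet> (transpose A ** C)"
proof -
  have "(A ** B) \<bullet> C = (\<Sum>i\<in>UNIV. \<Sum>j\<in>UNIV. \<Sum>k\<in>UNIV. A $ i $ k * B $ k $ j * C $ i $ j)"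
    by (simp add: inner_vec_def matrix_matrix_mult_def sum_distrib_right)
  also have "\<dots> = (\<Sum>i\<in>UNIV. \<Sum>k\<in>UNIV. \<Sum>j\<in>UNIV. A $ i $ k * B $ k $ j * C $ i $ j)"
    by (intro sum.cong refl sum.swap)
  also have "\<dots> = (\<Sum>k\<in>UNIV. \<Sum>i\<in>UNIV. \<Sum>j\<in>UNIV. A $ i $ k * B $ k $ j * C $ i $ j)"
    by (rule sum.swap)
  also have "\<dots> = (\<Sum>k\<in>UNIV. \<Sum>j\<in>UNIV. \<Sum>i\<in>UNIV. A $ i $ k * B $ k $ j * C $ i $ j)"
    by (intro sum.cong refl sum.swap)
  also have "\<dots> = B \<bullet> (transpose A ** C)"
    by (simp add: inner_vec_def matrix_matrix_mult_def transpose_def sum_distrib_left mult_ac)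
  finally show ?thesis .
qed

lemma inner_transpose:
  fixes A B :: "real^'m^'n"
  shows "transpose A \<bullet> transpose B = A \<bullet> B"
proof -
  have "transpose A \<bullet> transpose B = (\<Sum>j\<in>UNIV. \<Sum>i\<in>UNIV. A $ i $ j * B $ i $ j)"
    by (simp add: inner_vec_def transpose_def)
  also have "\<dots> = (\<Sum>i\<in>UNIV. \<Sum>j\<in>UNIV. A $ i $ j * B $ i $ j)"
    by (rule sum.swap)
  finally show ?thesis by (simp add: inner_vec_def)
qed

text \<open>Row \<open>i\<close> of \<open>A ** B\<close> is \<open>transpose B\<close> applied to
  row \<open>i\<close> of \<open>A\<close>, so the vector bound applies row by row.\<close>

lemma norm_matrix_mult_le:
  fixes A :: "real^'m^'n" and B :: "real^'k^'m"
  shows "norm (A ** B) \<le> norm A * norm B"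
proof -
  have row: "norm ((A ** B) $ i) \<le> norm (A $ i) * norm B" for i
  proof -
    have "(A ** B) $ i = transpose B *v (A $ i)"
      by (simp add: vec_eq_iff matrix_matrix_mult_def vector_matrix_mult_def mult.commute)
    also have "norm \<dots> \<le> norm (transpose B) * norm (A $ i)"
      by (rule norm_matrix_vector_mult_le)
    also have "norm (transpose B) = norm B"
      by (simp add: norm_eq_sqrt_inner inner_transpose)
    finally show ?thesis by (simp add: mult.commute)
  qed
  have "norm (A ** B) \<le> L2_set (\<lambda>i. norm (A $ i) * norm B) UNIV"
    unfolding norm_vec_def[of "A ** B"] by (intro L2_set_mono row) auto
  also have "\<dots> = norm A * norm B"
    by (simp add: L2_set_left_distrib norm_vec_def)
  finally show ?thesis .
qed

section \<open>Inverses, and matrices with orthonormal columns in the square case\<close>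

lemma matrix_inv_mult:
  fixes A :: "real^'m^'m"
  assumes "invertible A"
  shows "A ** matrix_inv A = mat 1" "matrix_inv A ** A = mat 1"
  using someI_ex[OF assms[unfolded invertible_def]] by (auto simp: matrix_inv_def)

lemma matrix_inv_unique:
  fixes A :: "real^'m^'m"
  assumes "A ** B = mat 1"
  shows "matrix_inv A = B"
proof -
  have "invertible A"
    using assms invertible_right_inverse by blast
  then have "matrix_inv A = matrix_inv A ** (A ** B)"
    by (simp add: assms)
  also have "\<dots> = B"
    using \<open>invertible A\<close> by (simp add: matrix_mul_assoc matrix_inv_mult)
  finally show ?thesis .
qed

lemma norm_mat_1: "(norm (mat 1 :: real^'m^'m))\<^sup>2 = real CARD('m)"
proof -
  have "(norm (mat 1 :: real^'m^'m))\<^sup>2 = (\<Sum>i\<in>UNIV. \<Sum>j\<in>UNIV. (if i = (j::'m) then 1 else 0))"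
    unfolding power2_norm_eq_inner inner_vec_def
    by (intro sum.cong refl) (auto simp: mat_def)
  then show ?thesis by simp
qed

text \<open>The index types \<open>'p\<close> and \<open>'n\<close> may differ although their
  cardinalities agree, so dimensions are compared by traces: for the projection
  \<open>P = X ** transpose X\<close>, the squared distance from \<open>P\<close> to the identity is
  p - 2 p + n = 0.\<close>

lemma orthonormal_columns_square:
  fixes X :: "real^'p^'n"
  assumes "transpose X ** X = mat 1" and "CARD('p) = CARD('n)"
  shows "X ** transpose X = mat 1"
proof -
  have XX: "(X ** transpose X) \<bullet> mat 1 = real CARD('p)"
    unfolding inner_matrix_mult_left using norm_mat_1[where 'm = 'p] assms(1)
    by (metis inner_matrix_mult_left matrix_mul_rid power2_norm_eq_inner inner_transpose)
  \<comment> \<open>\<open>P\<close> is symmetric and idempotent.\<close>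
  have PP: "(X ** transpose X) \<bullet> (X ** transpose X) = (X ** transpose X) \<bullet> mat 1"
    by (simp add: inner_matrix_mult_left matrix_mul_assoc assms(1))
  have "mat 1 \<bullet> (X ** transpose X) = (X ** transpose X) \<bullet> mat 1"
    by (rule inner_commute)
  then have "(norm (X ** transpose X - mat 1))\<^sup>2 = 0"
    using norm_mat_1[where 'm = 'n] assms(2) PP XX
    unfolding power2_norm_eq_inner inner_diff_left inner_diff_right by linarith
  then show ?thesis by simp
qed

section \<open>Eigenvalues of symmetric matrices\<close>

lemma symmetric_inner:
  fixes A :: "real^'m^'m"
  assumes "transpose A = A"
  shows "x \<bullet> (A *v y) = (A *v x) \<bullet> y"
  using dot_lmul_matrix[of x A y] transpose_matrix_vector[of A x] assms by simp

text \<open>Choose one eigenvector per eigenvalue. Distinct eigenvalues give orthogonal vectors, so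
  the choice is injective, and a pairwise orthogonal set in finite dimension is finite.\<close>

lemma finite_eigenvalues_symmetric:
  fixes A :: "real^'m^'m"
  assumes "transpose A = A"
  shows "finite (eigenvalues A)"
proof -
  have "\<forall>l\<in>eigenvalues A. \<exists>v. v \<noteq> 0 \<and> A *v v = l *\<^sub>R v"
    by (simp add: eigenvalues_def)
  then obtain v where v: "\<And>l. l \<in> eigenvalues A \<Longrightarrow> v l \<noteq> 0 \<and> A *v v l = l *\<^sub>R v l"
    by metis
  have orth: "v k \<bullet> v l = 0" if "k \<in> eigenvalues A" "l \<in> eigenvalues A" "k \<noteq> l" for k l
  proof -
    have "k * (v k \<bullet> v l) = l * (v k \<bullet> v l)"
      using symmetric_inner[OF assms, of "v k" "v l"] v that by simp
    then show ?thesis using that by simp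
  qed
  have "inj_on v (eigenvalues A)"
    using orth v by (metis inj_onI inner_eq_zero_iff)
  moreover have "pairwise orthogonal (v ` eigenvalues A)"
    using orth by (auto simp: pairwise_def orthogonal_def)
  ultimately show ?thesis
    using pairwise_orthogonal_imp_finite finite_imageD by blast
qed

text \<open>The maximizer of the Rayleigh quotient is an eigenvector.\<close>

lemma eigenvalues_symmetric_nonempty:
  fixes A :: "real^'m^'m"
  assumes "transpose A = A"
  shows "eigenvalues A \<noteq> {}"
proof -
  have "axis undefined 1 \<in> sphere (0::real^'m) 1" by simp
  then have "sphere (0::real^'m) 1 \<noteq> {}" by blast
  moreover have "continuous_on (sphere 0 1) (\<lambda>x. x \<bullet> (A *v x))"
    by (intro continuous_intros linear_continuous_on matrix_vector_mul_bounded_linear)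
  ultimately obtain v :: "real^'m" where "v \<in> sphere 0 1"
    and "\<forall>y\<in>sphere 0 1. y \<bullet> (A *v y) \<le> v \<bullet> (A *v v)"
    using continuous_attains_sup[OF compact_sphere] by blast
  then have v: "norm v = 1"
    and vmax: "\<And>y. norm y = 1 \<Longrightarrow> y \<bullet> (A *v y) \<le> v \<bullet> (A *v v)"
    by simp_all
  define l where "l = v \<bullet> (A *v v)"
  have vv: "v \<bullet> v = 1" using v by (simp add: norm_eq_1)
  have psd: "y \<bullet> (A *v y) \<le> l * (y \<bullet> y)" for y
  proof (cases "y = 0")
    case False
    define z where "z = (1 / norm y) *\<^sub>R y"
    have "z \<bullet> (A *v z) \<le> l"
      unfolding l_def z_def by (rule vmax) (use False in simp)
    then have "(y \<bullet> (A *v y)) / (norm y)\<^sup>2 \<le> l"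
      by (simp add: z_def matrix_vector_mult_scaleR power2_eq_square)
    then show ?thesis using False by (simp add: divide_le_eq power2_norm_eq_inner mult.commute)
  qed simp
  \<comment> \<open>\<open>w\<close> is the residual of the eigenvalue equation. Perturbing the
    maximizer \<open>v\<close> in this direction gives the first-order gain 2 t (w \<bullet> w),
    which \<open>psd\<close> allows only up to the second-order term with coefficient
    \<open>c\<close>; hence \<open>w\<close> vanishes.\<close>
  define w where "w = A *v v - l *\<^sub>R v"
  define c where "c = l * (w \<bullet> w) - w \<bullet> (A *v w)"
  have key: "2 * t * (w \<bullet> w) \<le> t\<^sup>2 * c" for t
  proof -
    have "(v + t *\<^sub>R w) \<bullet> (A *v (v + t *\<^sub>R w))
        = l + 2 * t * (w \<bullet> (A *v v)) + t\<^sup>2 * (w \<bullet> (A *v w))"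
      using symmetric_inner[OF assms, of v w]
      by (simp add: algebra_simps inner_simps l_def power2_eq_square inner_commute)
    moreover have "(v + t *\<^sub>R w) \<bullet> (v + t *\<^sub>R w) = 1 + 2 * t * (w \<bullet> v) + t\<^sup>2 * (w \<bullet> w)"
      by (simp add: inner_simps vv power2_eq_square inner_commute algebra_simps)
    moreover have "w \<bullet> (A *v v) = w \<bullet> w + l * (w \<bullet> v)"
      by (simp add: w_def inner_simps)
    ultimately have "l + 2 * t * (w \<bullet> w + l * (w \<bullet> v)) + t\<^sup>2 * (w \<bullet> (A *v w))
        \<le> l * (1 + 2 * t * (w \<bullet> v) + t\<^sup>2 * (w \<bullet> w))"
      using psd[of "v + t *\<^sub>R w"] by metis
    then show ?thesis by (simp add: c_def algebra_simps)
  qed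
  have "c \<ge> 0" using psd[of w] by (simp add: c_def)
  have "w \<bullet> w \<le> 0"
  proof (rule ccontr)
    assume "\<not> w \<bullet> w \<le> 0"
    then have pos: "w \<bullet> w > 0" by linarith
    \<comment> \<open>With this step length t (c + 1) = w \<bullet> w, so \<open>key\<close> would
      give 2 (w \<bullet> w) \<le> w \<bullet> w. The summand 1 keeps the denominator positive when
      \<open>c\<close> is 0.\<close>
    define t where "t = (w \<bullet> w) / (c + 1)"
    have t: "t > 0" using pos \<open>c \<ge> 0\<close> by (simp add: t_def)
    have "t * (2 * (w \<bullet> w)) \<le> t * (t * c)"
      using key[of t] by (simp add: power2_eq_square mult_ac)
    then have "2 * (w \<bullet> w) \<le> t * c"
      using t by (rule mult_left_le_imp_le)
    also have "\<dots> \<le> t * (c + 1)" using t by simp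
    also have "\<dots> = w \<bullet> w" using \<open>c \<ge> 0\<close> by (simp add: t_def)
    finally show False using pos by simp
  qed
  then have "A *v v = l *\<^sub>R v"
    by (metis eq_iff_diff_eq_0 inner_eq_zero_iff inner_ge_zero order_antisym w_def)
  then show ?thesis
    using v by (auto simp: eigenvalues_def intro!: exI[of _ l] exI[of _ v])
qed

text \<open>An eigenvector \<open>v\<close> of \<open>transpose A ** A\<close> for \<open>l\<close>
  satisfies \<open>(norm (A *v v))\<^sup>2 = l * (norm v)\<^sup>2\<close>, so the two bounds confine
  the spectrum to the interval from 1 to \<open>C\<^sup>2\<close>. Finiteness and nonemptiness make
  \<open>Max\<close> and \<open>Min\<close> genuine eigenvalues.\<close>

lemma cond_number_le:
  fixes A :: "real^'m^'n"
  assumes low: "\<And>x. norm x \<le> norm (A *v x)"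
    and upp: "\<And>x. norm (A *v x) \<le> C * norm x" and C: "C \<ge> 0"
  shows "cond_number A \<le> C"
proof -
  define E where "E = eigenvalues (transpose A ** A)"
  have sym: "transpose (transpose A ** A) = transpose A ** A"
    by (simp add: matrix_transpose_mul)
  have fin: "finite E" and ne: "E \<noteq> {}"
    unfolding E_def using finite_eigenvalues_symmetric[OF sym] eigenvalues_symmetric_nonempty[OF sym]
    by auto
  have bnd: "1 \<le> l \<and> l \<le> C\<^sup>2" if "l \<in> E" for l
  proof -
    from that obtain v where v: "v \<noteq> 0" "(transpose A ** A) *v v = l *\<^sub>R v"
      by (auto simp: E_def eigenvalues_def)
    have "(norm (A *v v))\<^sup>2 = v \<bullet> ((transpose A ** A) *v v)"
      by (simp add: power2_norm_eq_inner matrix_vector_mul_assoc[symmetric] dot_lmul_matrix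
          inner_commute[of v])
    then have e: "(norm (A *v v))\<^sup>2 = l * (norm v)\<^sup>2"
      by (simp add: v power2_norm_eq_inner)
    have pos: "(norm v)\<^sup>2 > 0" using v by simp
    have "1 * (norm v)\<^sup>2 \<le> l * (norm v)\<^sup>2"
      using power_mono[OF low norm_ge_zero, of v 2] e by simp
    moreover have "l * (norm v)\<^sup>2 \<le> C\<^sup>2 * (norm v)\<^sup>2"
      using power_mono[OF upp norm_ge_zero, of v 2] e by (simp add: power_mult_distrib)
    ultimately show ?thesis using pos mult_le_cancel_right_pos by blast
  qed
  have "1 \<le> Min E" "Max E \<le> C\<^sup>2"
    using fin ne bnd by auto
  then have "Max E / Min E \<le> C\<^sup>2 / 1"
    using bnd[OF Max_in[OF fin ne]] by (intro frac_le) auto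
  then show ?thesis
    unfolding cond_number_def E_def[symmetric] using C real_le_lsqrt[of C "Max E / Min E"]
    by (metis div_by_1)
qed

section \<open>The curve for a general skew-symmetric part\<close>

text \<open>Detaches the curve from \<open>F\<close>: \<open>K\<close> takes the place of
  \<open>transpose X ** D_mat F \<rho> X\<close>, and only its skew-symmetry and
  \<open>transpose X ** W = 0\<close> enter the lemmas below.\<close>

definition curve_J :: "real^'p^'n \<Rightarrow> real^'p^'p \<Rightarrow> real \<Rightarrow> real^'p^'p" where
  "curve_J W K \<tau> = mat 1 + (\<tau>\<^sup>2 / 4) *\<^sub>R (transpose W ** W) + (\<tau> / 2) *\<^sub>R K"

definition curve_Y :: "real^'p^'n \<Rightarrow> real^'p^'n \<Rightarrow> real^'p^'p \<Rightarrow> real \<Rightarrow> real^'p^'n" where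
  "curve_Y X W K \<tau> = (2 *\<^sub>R X + \<tau> *\<^sub>R W) ** matrix_inv (curve_J W K \<tau>) - X"

lemma inner_skew_eq_0:
  fixes K :: "real^'m^'m"
  assumes "transpose K = - K"
  shows "x \<bullet> (K *v x) = 0"
proof -
  have "x \<bullet> (K *v x) = (transpose K *v x) \<bullet> x"
    by (simp add: dot_lmul_matrix)
  also have "\<dots> = - (x \<bullet> (K *v x))"
    \<comment> \<open>The instance with \<open>0\<close> gives the rule for
      \<open>(- K) *v x\<close>.\<close>
    unfolding assms using matrix_vector_mult_diff_rdistrib[of 0 K x]
    by (simp add: inner_commute)
  finally show ?thesis by simp
qed

lemma curve_J_vector:
  fixes W :: "real^'p^'n"
  shows "curve_J W K \<tau> *v x
    = x + (\<tau>\<^sup>2 / 4) *\<^sub>R (transpose W *v (W *v x)) + (\<tau> / 2) *\<^sub>R (K *v x)"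
  unfolding curve_J_def matrix_vector_mult_add_rdistrib scaleR_matrix_vector_assoc[symmetric]
    matrix_vector_mul_assoc[symmetric] matrix_vector_mul_lid ..

text \<open>Pair \<open>curve_J W K \<tau> *v x\<close> with \<open>x\<close>: the skew term drops
  out, the \<open>W\<close> term is a nonnegative square, and Cauchy-Schwarz allows division by
  \<open>norm x\<close>.\<close>

lemma norm_le_curve_J:
  fixes W :: "real^'p^'n"
  assumes "transpose K = - K"
  shows "norm x \<le> norm (curve_J W K \<tau> *v x)"
proof (cases "x = 0")
  case False
  have "x \<bullet> (curve_J W K \<tau> *v x) = x \<bullet> x + (\<tau>\<^sup>2 / 4) * ((W *v x) \<bullet> (W *v x))"
    by (simp add: curve_J_vector inner_add_right inner_skew_eq_0[OF assms] dot_lmul_matrix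
        inner_commute[of x "_ v* _"])
  also have "\<dots> \<ge> x \<bullet> x" by simp
  finally have "norm x * norm x \<le> norm x * norm (curve_J W K \<tau> *v x)"
    using norm_cauchy_schwarz[of x "curve_J W K \<tau> *v x"]
    by (simp add: power2_norm_eq_inner[symmetric] power2_eq_square)
  then show ?thesis using False by simp
qed simp

lemma invertible_curve_J:
  fixes W :: "real^'p^'n"
  assumes "transpose K = - K"
  shows "invertible (curve_J W K \<tau>)"
proof -
  have "\<forall>x. curve_J W K \<tau> *v x = 0 \<longrightarrow> x = 0"
    using norm_le_curve_J[OF assms, of _ W \<tau>] by (metis norm_le_zero_iff norm_zero)
  then show ?thesis
    by (simp add: invertible_left_inverse matrix_left_invertible_ker)
qed

lemma cond_number_curve_J_le:
  fixes W :: "real^'p^'n"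
  assumes "transpose K = - K"
  shows "cond_number (curve_J W K \<tau>) \<le> (5 + \<tau>\<^sup>2 * ((norm W)\<^sup>2 + (norm K)\<^sup>2)) / 4"
proof -
  define k where "k = \<bar>\<tau>\<bar> / 2 * norm K"
  define C where "C = 1 + \<tau>\<^sup>2 / 4 * (norm W)\<^sup>2 + k"
  have "norm (curve_J W K \<tau> *v x) \<le> C * norm x" for x
  proof -
    have "norm (transpose W *v (W *v x)) \<le> norm (transpose W) * (norm W * norm x)"
      by (intro order_trans[OF norm_matrix_vector_mult_le] mult_left_mono
          norm_matrix_vector_mult_le norm_ge_zero)
    then have WW: "norm (transpose W *v (W *v x)) \<le> (norm W)\<^sup>2 * norm x"
      by (simp add: norm_eq_sqrt_inner[of "transpose W"] inner_transpose
          norm_eq_sqrt_inner[of W, symmetric] power2_eq_square mult_ac)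
    have "norm (curve_J W K \<tau> *v x)
        \<le> norm x + norm ((\<tau>\<^sup>2 / 4) *\<^sub>R (transpose W *v (W *v x))) + norm ((\<tau> / 2) *\<^sub>R (K *v x))"
      unfolding curve_J_vector by (intro norm_triangle_mono norm_triangle_ineq order_refl)
    also have "\<dots> = norm x + \<tau>\<^sup>2 / 4 * norm (transpose W *v (W *v x)) + \<bar>\<tau>\<bar> / 2 * norm (K *v x)"
      by (simp only: norm_scaleR) simp
    also have "\<dots> \<le> norm x + \<tau>\<^sup>2 / 4 * ((norm W)\<^sup>2 * norm x) + \<bar>\<tau>\<bar> / 2 * (norm K * norm x)"
      by (intro add_mono mult_left_mono WW norm_matrix_vector_mult_le order_refl) auto
    also have "\<dots> = C * norm x" by (simp add: C_def k_def algebra_simps)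
    finally show ?thesis .
  qed
  then have "cond_number (curve_J W K \<tau>) \<le> C"
    by (intro cond_number_le norm_le_curve_J[OF assms]) (auto simp: C_def k_def)
  \<comment> \<open>Here k \<le> \<open>k\<^sup>2 + 1 / 4\<close> raises the constant 1 to 5/4 and
    gives \<open>norm K\<close> the same weight \<open>\<tau>\<^sup>2 / 4\<close> and the same power
    as \<open>norm W\<close>, so that Pythagoras can later merge them into the norm of the
    direction.\<close>
  also have "C \<le> (5 + \<tau>\<^sup>2 * (norm W)\<^sup>2) / 4 + k\<^sup>2"
    using zero_le_power2[of "k - 1 / 2"] by (simp add: C_def power2_diff power2_eq_square field_simps)
  also have "\<dots> = (5 + \<tau>\<^sup>2 * ((norm W)\<^sup>2 + (norm K)\<^sup>2)) / 4"
    by (simp add: k_def power_mult_distrib power_divide algebra_simps add_divide_distrib)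
  finally show ?thesis .
qed

text \<open>A bound uniform in \<tau>, for the limit at 0. Each column of the inverse is mapped by
  \<open>curve_J W K \<tau>\<close> to a unit vector and so has norm at most 1. The transpose turns
  columns into rows, over which the norm is built.\<close>

lemma norm_matrix_inv_curve_J_le:
  fixes W :: "real^'p^'n"
  assumes "transpose K = - K"
  shows "norm (matrix_inv (curve_J W K \<tau>)) \<le> norm (mat 1 :: real^'p^'p)"
proof -
  let ?H = "matrix_inv (curve_J W K \<tau>)"
  have col: "norm (row i (transpose ?H)) \<le> norm (row i (mat 1 :: real^'p^'p))" for i
  proof -
    have "norm (?H *v axis i 1) \<le> norm (curve_J W K \<tau> *v (?H *v axis i 1))"
      by (rule norm_le_curve_J[OF assms])
    also have "curve_J W K \<tau> *v (?H *v axis i 1) = axis i 1"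
      by (simp add: matrix_vector_mul_assoc matrix_inv_mult[OF invertible_curve_J[OF assms]])
    finally have "norm (column i ?H) \<le> norm (axis i 1 :: real^'p)"
      by (simp only: matrix_vector_mult_basis)
    moreover have "row i (mat 1 :: real^'p^'p) = axis i 1"
      by (auto simp: row_def mat_def axis_def vec_eq_iff)
    ultimately show ?thesis by simp
  qed
  have "norm ?H = norm (transpose ?H)"
    by (simp add: norm_eq_sqrt_inner inner_transpose)
  also have "\<dots> \<le> norm (mat 1 :: real^'p^'p)"
    using col unfolding norm_vec_def[of "transpose ?H"] norm_vec_def[of "mat 1 :: real^'p^'p"]
    by (intro L2_set_mono) (auto simp: row_def vec_lambda_eta simp del: row_transpose)
  finally show ?thesis .
qed

lemma curve_Y_orthonormal:
  fixes X :: "real^'p^'n"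
  assumes X: "transpose X ** X = mat 1" and XW: "transpose X ** W = 0"
    and K: "transpose K = - K"
  shows "transpose (curve_Y X W K \<tau>) ** curve_Y X W K \<tau> = mat 1"
proof -
  let ?J = "curve_J W K \<tau>"
  let ?H = "matrix_inv ?J"
  let ?V = "2 *\<^sub>R X + \<tau> *\<^sub>R W"
  note inv = matrix_inv_mult[OF invertible_curve_J[OF K], of W \<tau>]
  have HJt: "transpose ?H ** transpose ?J = mat 1"
    using inv(1) by (metis matrix_transpose_mul transpose_mat)
  have WX: "transpose W ** X = 0"
    using arg_cong[OF XW, of transpose] by (simp add: matrix_transpose_mul transpose_linear_simps)
  \<comment> \<open>The skew part cancels in the sum.\<close>
  have JJ: "2 *\<^sub>R (?J + transpose ?J) = 4 *\<^sub>R mat 1 + \<tau>\<^sup>2 *\<^sub>R (transpose W ** W)"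
    by (simp add: curve_J_def transpose_linear_simps matrix_transpose_mul K vec_eq_iff)
  have VV: "transpose ?V ** ?V = 2 *\<^sub>R (?J + transpose ?J)"
    unfolding JJ
    by (simp add: transpose_linear_simps matrix_mult_bilinear_simps X XW WX power2_eq_square)
  have VX: "transpose ?V ** X = 2 *\<^sub>R mat 1" and XV: "transpose X ** ?V = 2 *\<^sub>R mat 1"
    by (simp_all add: transpose_linear_simps matrix_mult_bilinear_simps X XW WX)
  have "transpose (curve_Y X W K \<tau>) ** curve_Y X W K \<tau>
      = transpose ?H ** (transpose ?V ** ?V) ** ?H - transpose ?H ** (transpose ?V ** X)
        - (transpose X ** ?V) ** ?H + transpose X ** X"
    unfolding curve_Y_def transpose_linear_simps(2) matrix_transpose_mul
      bounded_bilinear.diff_left[OF bounded_bilinear_matrix_mult]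
      bounded_bilinear.diff_right[OF bounded_bilinear_matrix_mult] matrix_mul_assoc
    by simp
  \<comment> \<open>Between \<open>transpose ?H\<close> and \<open>?H\<close>, the sum
    \<open>?J + transpose ?J\<close> collapses to \<open>transpose ?H + ?H\<close>, which cancels
    the cross terms.\<close>
  also have "\<dots> = 2 *\<^sub>R (transpose ?H ** (?J ** ?H)) + 2 *\<^sub>R ((transpose ?H ** transpose ?J) ** ?H)
        - 2 *\<^sub>R transpose ?H - 2 *\<^sub>R ?H + mat 1"
    unfolding VV VX XV X by (simp add: matrix_mult_bilinear_simps matrix_mul_assoc algebra_simps)
  also have "\<dots> = mat 1"
    unfolding inv HJt by simp
  finally show ?thesis .
qed

text \<open>Writing J = I + \<tau> M and 2 X + \<tau> W = 2 X J + \<tau> (W - 2 X M) exposes an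
  exact factor \<tau>. The derivative at 0 is then just the limit of the cofactor, and the inverse
  need only be continuous there.\<close>

lemma curve_Y_eq:
  fixes X :: "real^'p^'n"
  assumes K: "transpose K = - K"
  shows "curve_Y X W K \<tau> = X + \<tau> *\<^sub>R
    ((W - 2 *\<^sub>R (X ** ((\<tau> / 4) *\<^sub>R (transpose W ** W) + (1 / 2) *\<^sub>R K)))
      ** matrix_inv (curve_J W K \<tau>))"
proof -
  let ?J = "curve_J W K \<tau>"
  let ?M = "(\<tau> / 4) *\<^sub>R (transpose W ** W) + (1 / 2) *\<^sub>R K"
  have J: "?J = mat 1 + \<tau> *\<^sub>R ?M"
    by (simp add: curve_J_def algebra_simps power2_eq_square)
  have "2 *\<^sub>R X + \<tau> *\<^sub>R W = 2 *\<^sub>R (X ** ?J) + \<tau> *\<^sub>R (W - 2 *\<^sub>R (X ** ?M))"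
    unfolding J by (simp only: matrix_mult_bilinear_simps matrix_mul_rid) (simp add: algebra_simps)
  then have "(2 *\<^sub>R X + \<tau> *\<^sub>R W) ** matrix_inv ?J
      = 2 *\<^sub>R (X ** (?J ** matrix_inv ?J)) + \<tau> *\<^sub>R ((W - 2 *\<^sub>R (X ** ?M)) ** matrix_inv ?J)"
    by (simp only: matrix_mult_bilinear_simps matrix_mul_assoc)
  then show ?thesis
    unfolding curve_Y_def matrix_inv_mult(1)[OF invertible_curve_J[OF K]] by (simp add: scaleR_2)
qed

text \<open>With H the inverse of J, H - I = (I - J) H, where H is bounded uniformly in \<tau> and J
  tends to I.\<close>

lemma curve_J_inv_tendsto:
  fixes W :: "real^'p^'n"
  assumes K: "transpose K = - K"
  shows "((\<lambda>\<tau>. matrix_inv (curve_J W K \<tau>)) \<longlongrightarrow> mat 1) (at 0)"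
proof -
  define c where "c = norm (mat 1 :: real^'p^'p)"
  have bound: "norm (matrix_inv (curve_J W K \<tau>) - mat 1) \<le> norm (curve_J W K \<tau> - mat 1) * c" for \<tau>
  proof -
    have "matrix_inv (curve_J W K \<tau>) - mat 1 = (mat 1 - curve_J W K \<tau>) ** matrix_inv (curve_J W K \<tau>)"
      by (simp add: matrix_mult_bilinear_simps matrix_inv_mult invertible_curve_J[OF K])
    then have "norm (matrix_inv (curve_J W K \<tau>) - mat 1)
        \<le> norm (mat 1 - curve_J W K \<tau>) * norm (matrix_inv (curve_J W K \<tau>))"
      by (simp add: norm_matrix_mult_le)
    also have "\<dots> \<le> norm (mat 1 - curve_J W K \<tau>) * c"
      unfolding c_def by (intro mult_left_mono norm_matrix_inv_curve_J_le[OF K]) simp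
    finally show ?thesis by (simp add: norm_minus_commute)
  qed
  have "(curve_J W K \<longlongrightarrow> mat 1 + (0\<^sup>2 / 4) *\<^sub>R (transpose W ** W) + (0 / 2) *\<^sub>R K) (at 0)"
    unfolding curve_J_def by (intro tendsto_intros) auto
  then have "((\<lambda>\<tau>. norm (curve_J W K \<tau> - mat 1) * c) \<longlongrightarrow> 0) (at 0)"
    by (intro tendsto_mult_left_zero tendsto_norm_zero LIM_zero) simp
  then have "((\<lambda>\<tau>. matrix_inv (curve_J W K \<tau>) - mat 1) \<longlongrightarrow> 0) (at 0)"
    by (rule Lim_null_comparison[rotated]) (simp add: bound)
  then show ?thesis by (rule LIM_zero_cancel)
qed

lemma curve_Y_0:
  assumes "transpose K = - K"
  shows "curve_Y X W K 0 = X"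
  using curve_Y_eq[OF assms, of X W 0] by simp

lemma curve_Y_derivative:
  fixes X :: "real^'p^'n"
  assumes K: "transpose K = - K"
  shows "(curve_Y X W K has_vector_derivative W - X ** K) (at 0)"
proof -
  let ?q = "\<lambda>\<tau>. (W - 2 *\<^sub>R (X ** ((\<tau> / 4) *\<^sub>R (transpose W ** W) + (1 / 2) *\<^sub>R K)))
      ** matrix_inv (curve_J W K \<tau>)"
  have "(?q \<longlongrightarrow> (W - 2 *\<^sub>R (X ** ((0 / 4) *\<^sub>R (transpose W ** W) + (1 / 2) *\<^sub>R K))) ** mat 1) (at 0)"
    by (intro tendsto_intros tendsto_matrix_mult curve_J_inv_tendsto[OF K]) auto
  then have lim: "(?q \<longlongrightarrow> W - X ** K) (at 0)"
    by (simp add: matrix_mult_bilinear_simps)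
  \<comment> \<open>The remainder quotient of the derivative equals the distance of the cofactor
    from its limit.\<close>
  have "norm (curve_Y X W K h - curve_Y X W K 0 - h *\<^sub>R (W - X ** K)) / norm h
      = norm (?q h - (W - X ** K))" if "h \<noteq> 0" for h
  proof -
    have "curve_Y X W K h - curve_Y X W K 0 - h *\<^sub>R (W - X ** K) = h *\<^sub>R (?q h - (W - X ** K))"
      unfolding curve_Y_0[OF K] curve_Y_eq[OF K, of X W h] by (simp add: algebra_simps)
    then show ?thesis using that by (simp only: norm_scaleR) simp
  qed
  then have "\<forall>\<^sub>F h in at 0. norm (?q h - (W - X ** K))
      = norm (curve_Y X W K h - curve_Y X W K 0 - h *\<^sub>R (W - X ** K)) / norm h"
    by (auto simp: eventually_at_filter)
  moreover have "((\<lambda>h. norm (?q h - (W - X ** K))) \<longlongrightarrow> 0) (at 0)"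
    using lim by (intro tendsto_norm_zero LIM_zero)
  ultimately show ?thesis
    using Lim_transform_eventually
    by (fastforce simp: has_vector_derivative_def has_derivative_at bounded_linear_scaleR_left)
qed

lemma curve_Y_orbit:
  fixes X :: "real^'p^'n"
  assumes X: "transpose X ** X = mat 1" and XW: "transpose X ** W = 0"
    and K: "transpose K = - K" and Q: "orthogonal_matrix Q" and "\<tau> \<noteq> 0"
    and eq: "curve_Y X W K \<tau> ** Q = X"
  shows "W = 0"
proof -
  let ?J = "curve_J W K \<tau>"
  have "curve_Y X W K \<tau> = curve_Y X W K \<tau> ** (Q ** transpose Q)"
    using Q by (simp add: orthogonal_matrix_def)
  also have "\<dots> = X ** transpose Q"
    by (simp add: matrix_mul_assoc eq)
  finally have "(2 *\<^sub>R X + \<tau> *\<^sub>R W) ** matrix_inv ?J = X ** (mat 1 + transpose Q)"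
    by (simp add: curve_Y_def matrix_mult_bilinear_simps algebra_simps)
  then have "(2 *\<^sub>R X + \<tau> *\<^sub>R W) ** (matrix_inv ?J ** ?J) = X ** (mat 1 + transpose Q) ** ?J"
    by (simp add: matrix_mul_assoc)
  \<comment> \<open>The right side has its columns in the range of \<open>X\<close>, to which
    \<open>W\<close> is orthogonal.\<close>
  then have V: "2 *\<^sub>R X + \<tau> *\<^sub>R W = X ** ((mat 1 + transpose Q) ** ?J)"
    by (simp add: matrix_inv_mult invertible_curve_J[OF K] matrix_mul_assoc)
  have "transpose X ** (2 *\<^sub>R X + \<tau> *\<^sub>R W) = (mat 1 + transpose Q) ** ?J"
    unfolding V by (simp add: matrix_mul_assoc X)
  then have "(mat 1 + transpose Q) ** ?J = 2 *\<^sub>R mat 1"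
    by (simp add: matrix_mult_bilinear_simps X XW)
  then have "2 *\<^sub>R X + \<tau> *\<^sub>R W = 2 *\<^sub>R X"
    unfolding V by (simp only: matrix_mult_bilinear_simps matrix_mul_rid)
  then have "\<tau> *\<^sub>R W = 0" by simp
  with \<open>\<tau> \<noteq> 0\<close> show ?thesis by simp
qed

section \<open>The gradients and the search direction\<close>

text \<open>A linear map is determined on the standard basis, and there the derivative returns the
  partial derivatives. Differentiability ensures that each \<open>deriv\<close> in the gradient is a
  true derivative.\<close>

lemma has_derivative_euclidean_gradient:
  fixes F :: "real^'p^'n \<Rightarrow> real"
  assumes "F differentiable (at X)"
  shows "(F has_derivative (\<bullet>) (euclidean_gradient F X)) (at X)"
proof -
  obtain F' where F': "(F has_derivative F') (at X)"
    using assms by (auto simp: differentiable_def)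
  then have lin: "linear F'"
    by (simp add: has_derivative_linear)
  have dir: "((\<lambda>t. F (X + t *\<^sub>R E)) has_real_derivative F' E) (at 0)" for E
  proof -
    have "(F has_derivative F') (at (X + 0 *\<^sub>R E))" using F' by simp
    then have "((\<lambda>t. F (X + t *\<^sub>R E)) has_derivative (\<lambda>t. F' (0 + t *\<^sub>R E))) (at 0)"
      by (rule has_derivative_compose[rotated]) (auto intro!: derivative_eq_intros)
    then show ?thesis
      by (simp add: has_field_derivative_def linear_cmul[OF lin] mult_commute_abs)
  qed
  have basis: "F' b = euclidean_gradient F X \<bullet> b" if b_Basis: "b \<in> Basis" for b
  proof -
    obtain i j where b: "b = axis i (axis j 1)"
      using b_Basis by (auto simp: Basis_vec_def)
    show ?thesis
      unfolding b using DERIV_imp_deriv[OF dir, of "axis i (axis j 1)"]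
      by (simp add: euclidean_gradient_def inner_axis)
  qed
  have "F' = (\<bullet>) (euclidean_gradient F X)"
    by (rule linear_eq_stdbasis[OF lin]) (simp_all add: basis bounded_linear.linear bounded_linear_inner_right)
  with F' show ?thesis by simp
qed

lemma has_derivative_along:
  fixes F :: "real^'p^'n \<Rightarrow> real"
  assumes "F differentiable (at (Y 0))" and "(Y has_vector_derivative E) (at 0)"
  shows "((\<lambda>\<tau>. F (Y \<tau>)) has_real_derivative euclidean_gradient F (Y 0) \<bullet> E) (at 0)"
proof -
  have "((\<lambda>\<tau>. F (Y \<tau>)) has_derivative (\<lambda>t. euclidean_gradient F (Y 0) \<bullet> (t *\<^sub>R E))) (at 0)"
    using assms(2) has_derivative_euclidean_gradient[OF assms(1)]
    unfolding has_vector_derivative_def by (rule has_derivative_compose)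
  then show ?thesis
    by (simp add: has_field_derivative_def mult_commute_abs)
qed

section \<open>Orthogonal splitting of gradient and direction at a point with orthonormal
  columns\<close>

context
  fixes F :: "real^'p^'n \<Rightarrow> real" and X :: "real^'p^'n"
  assumes X: "transpose X ** X = mat 1"
begin

lemma transpose_mult_cancel: "transpose X ** (X ** A) = A"
  by (simp add: matrix_mul_assoc X)

text \<open>The right side is a matrix minus its transpose; \<open>D_mat_skew\<close> rests on
  this.\<close>

lemma transpose_mult_stiefel_gradient:
  "transpose X ** stiefel_gradient F X =
    transpose X ** euclidean_gradient F X - transpose (transpose X ** euclidean_gradient F X)"
  by (simp add: stiefel_gradient_def matrix_mult_bilinear_simps matrix_transpose_mul
      transpose_mult_cancel flip: matrix_mul_assoc)

lemma transpose_mult_D_mat: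
  "transpose X ** D_mat F \<rho> X = (2 * \<rho>) *\<^sub>R (transpose X ** stiefel_gradient F X)"
  by (simp add: D_mat_def matrix_mult_bilinear_simps transpose_mult_cancel algebra_simps
      flip: matrix_mul_assoc)

lemma D_mat_skew:
  "transpose (transpose X ** D_mat F \<rho> X) = - (transpose X ** D_mat F \<rho> X)"
  by (simp add: transpose_mult_D_mat transpose_mult_stiefel_gradient transpose_linear_simps
      algebra_simps del: matrix_transpose_mul)

lemma D_mat_eq:
  "D_mat F \<rho> X = euclidean_gradient F X
    - X ** ((2 * \<rho>) *\<^sub>R (transpose (euclidean_gradient F X) ** X)
          + (1 - 2 * \<rho>) *\<^sub>R (transpose X ** euclidean_gradient F X))"
  by (simp add: D_mat_def stiefel_gradient_def matrix_mult_bilinear_simps transpose_mult_cancel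
      algebra_simps flip: matrix_mul_assoc)

text \<open>The direction differs from the gradient by a matrix \<open>X ** A\<close>, which the
  projection annihilates, so \<open>W_mat F \<rho> X\<close> is the same for every \<rho>.\<close>

lemma W_mat_eq:
  "W_mat F \<rho> X = X ** (transpose X ** euclidean_gradient F X) - euclidean_gradient F X"
  by (simp add: W_mat_def D_mat_eq matrix_mult_bilinear_simps transpose_mult_cancel
      algebra_simps flip: matrix_mul_assoc)

lemma transpose_mult_W_mat: "transpose X ** W_mat F \<rho> X = 0"
  by (simp add: W_mat_eq matrix_mult_bilinear_simps transpose_mult_cancel)

lemma inner_range_W_mat: "(X ** A) \<bullet> W_mat F \<rho> X = 0"
  by (simp add: inner_matrix_mult_left transpose_mult_W_mat)

lemma norm_range: "norm (X ** A) = norm A"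
  by (simp add: norm_eq_sqrt_inner inner_matrix_mult_left transpose_mult_cancel)

text \<open>Pythagoras, with \<open>X\<close> acting as an isometry. It serves both
  \<open>D_mat F \<rho> X\<close> and \<open>stiefel_gradient F X\<close>.\<close>

lemma norm_range_minus_W_mat:
  "(norm (X ** A - W_mat F \<rho> X))\<^sup>2 = (norm A)\<^sup>2 + (norm (W_mat F \<rho> X))\<^sup>2"
proof -
  have "(norm (X ** A - W_mat F \<rho> X))\<^sup>2 = (norm (X ** A))\<^sup>2 + (norm (W_mat F \<rho> X))\<^sup>2"
    by (simp add: power2_norm_eq_inner inner_diff_left inner_diff_right inner_range_W_mat
        inner_commute[of "W_mat F \<rho> X" "X ** A"])
  then show ?thesis by (simp add: norm_range)
qed

lemma D_mat_decomp: "D_mat F \<rho> X = X ** (transpose X ** D_mat F \<rho> X) - W_mat F \<rho> X"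
  by (simp add: W_mat_def matrix_mult_bilinear_simps matrix_mul_assoc)

text \<open>Same normal component as in \<open>D_mat_decomp\<close>: passing to the direction only
  rescales the part in the range of \<open>X\<close>, by 2 \<rho>.\<close>

lemma stiefel_gradient_decomp:
  "stiefel_gradient F X = X ** (transpose X ** stiefel_gradient F X) - W_mat F \<rho> X"
  by (simp add: W_mat_eq transpose_mult_stiefel_gradient stiefel_gradient_def
      matrix_mult_bilinear_simps matrix_transpose_mul transpose_mult_cancel flip: matrix_mul_assoc)

text \<open>The factor \<open>\<rho>\<close> is \<open>2 * \<rho> / 2\<close>: pairing with a skew-symmetric matrix sees only half of
  \<open>transpose X ** stiefel_gradient F X\<close>.\<close>

lemma inner_gradient_D_mat:
  "euclidean_gradient F X \<bullet> D_mat F \<rho> X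
    = \<rho> * (norm (transpose X ** stiefel_gradient F X))\<^sup>2 + (norm (W_mat F \<rho> X))\<^sup>2"
proof -
  let ?G = "euclidean_gradient F X"
  let ?A = "transpose X ** stiefel_gradient F X"
  define B where "B = transpose X ** ?G"
  have A: "?A = B - transpose B"
    by (simp only: transpose_mult_stiefel_gradient B_def)
  \<comment> \<open>\<open>B\<close> and \<open>transpose B\<close> have equal norms, so both halves
    of the expansion agree.\<close>
  have "?A \<bullet> ?A = 2 * (B \<bullet> ?A)"
    using inner_transpose[of B B] inner_commute[of B "transpose B"]
    unfolding A by (simp add: inner_diff_left inner_diff_right)
  moreover have "?G \<bullet> (X ** ?A) = B \<bullet> ?A"
    unfolding B_def by (metis inner_commute inner_matrix_mult_left)
  moreover have "?G = X ** B - W_mat F \<rho> X"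
    by (simp add: W_mat_eq B_def)
  then have "?G \<bullet> W_mat F \<rho> X = - (norm (W_mat F \<rho> X))\<^sup>2"
    by (metis diff_0 inner_diff_left inner_range_W_mat power2_norm_eq_inner)
  moreover have "D_mat F \<rho> X = (2 * \<rho>) *\<^sub>R (X ** ?A) - W_mat F \<rho> X"
    using D_mat_decomp[of \<rho>]
    by (simp only: transpose_mult_D_mat matrix_mult_bilinear_simps)
  ultimately show ?thesis
    by (simp add: inner_diff_right power2_norm_eq_inner[of ?A])
qed

text \<open>The two orthogonal components carry the weights \<rho> and 1, each at least
  \<open>min \<rho> 1\<close>.\<close>

lemma inner_gradient_D_mat_ge:
  "min \<rho> 1 * (norm (stiefel_gradient F X))\<^sup>2 \<le> euclidean_gradient F X \<bullet> D_mat F \<rho> X"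
proof -
  let ?A = "transpose X ** stiefel_gradient F X"
  have "(norm (stiefel_gradient F X))\<^sup>2 = (norm ?A)\<^sup>2 + (norm (W_mat F \<rho> X))\<^sup>2"
    using norm_range_minus_W_mat stiefel_gradient_decomp by metis
  moreover have "min \<rho> 1 * (norm ?A)\<^sup>2 \<le> \<rho> * (norm ?A)\<^sup>2"
    "min \<rho> 1 * (norm (W_mat F \<rho> X))\<^sup>2 \<le> 1 * (norm (W_mat F \<rho> X))\<^sup>2"
    by (intro mult_right_mono; simp)+
  ultimately show ?thesis
    by (simp add: inner_gradient_D_mat distrib_left)
qed

section \<open>The general curve specialized to the objective function\<close>

lemma J_mat_eq: "J_mat F \<rho> X = curve_J (W_mat F \<rho> X) (transpose X ** D_mat F \<rho> X)"
  by (simp add: fun_eq_iff J_mat_def curve_J_def)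

lemma Y_curve_eq: "Y_curve F \<rho> X = curve_Y X (W_mat F \<rho> X) (transpose X ** D_mat F \<rho> X)"
  by (simp add: fun_eq_iff Y_curve_def curve_Y_def J_mat_eq)

lemma Y_curve_0: "Y_curve F \<rho> X 0 = X"
  by (simp add: Y_curve_eq curve_Y_0 D_mat_skew)

lemma Y_curve_derivative: "(Y_curve F \<rho> X has_vector_derivative - D_mat F \<rho> X) (at 0)"
proof -
  have "- D_mat F \<rho> X = W_mat F \<rho> X - X ** (transpose X ** D_mat F \<rho> X)"
    using D_mat_decomp[of \<rho>] by (metis minus_diff_eq)
  then show ?thesis
    unfolding Y_curve_eq using curve_Y_derivative[OF D_mat_skew] by metis
qed

text \<open>The chain rule is applied to a straight line, as in \<open>descent_direction\<close>,
  and not to the curve. A nonzero gradient and \<rho> > 0 make the slope strictly negative.\<close>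

lemma descent_direction_D_mat:
  assumes "F differentiable (at X)" and "\<rho> > 0" and "stiefel_gradient F X \<noteq> 0"
  shows "descent_direction F X (- D_mat F \<rho> X)"
proof -
  have "((\<lambda>t. X + t *\<^sub>R (- D_mat F \<rho> X)) has_vector_derivative - D_mat F \<rho> X) (at 0)"
    by (auto intro!: derivative_eq_intros)
  then have "((\<lambda>t. F (X + t *\<^sub>R (- D_mat F \<rho> X))) has_real_derivative
      euclidean_gradient F X \<bullet> (- D_mat F \<rho> X)) (at 0)"
    using has_derivative_along[of F "\<lambda>t. X + t *\<^sub>R (- D_mat F \<rho> X)"
        "- D_mat F \<rho> X"] assms(1)
    by (simp del: inner_minus_right)
  moreover have "0 < min \<rho> 1 * (norm (stiefel_gradient F X))\<^sup>2"
    using assms by simp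
  then have "euclidean_gradient F X \<bullet> (- D_mat F \<rho> X) < 0"
    using inner_gradient_D_mat_ge[of \<rho>] by simp
  ultimately show ?thesis
    unfolding descent_direction_def by blast
qed

lemma cond_number_J_mat_le:
  "cond_number (J_mat F \<rho> X \<tau>) \<le> (5 + (\<tau> * norm (D_mat F \<rho> X))\<^sup>2) / 4"
  using cond_number_curve_J_le[OF D_mat_skew, of "W_mat F \<rho> X" \<rho> \<tau>]
    norm_range_minus_W_mat[of "transpose X ** D_mat F \<rho> X" \<rho>] D_mat_decomp[of \<rho>]
  by (simp add: J_mat_eq power_mult_distrib add.commute)

lemma W_mat_square:
  assumes "CARD('p) = CARD('n)"
  shows "W_mat F \<rho> X = 0"
  by (simp add: W_mat_eq matrix_mul_assoc orthonormal_columns_square[OF X assms])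

text \<open>With one column, every \<open>'p\<close> by \<open>'p\<close> matrix is a multiple of
  the identity, so J is the scalar \<open>c \<tau> j\<close> and inverting it is division.\<close>

lemma Y_curve_vector:
  assumes p: "CARD('p) = 1"
  defines "x \<equiv> \<lambda>j. column j X" and "g \<equiv> \<lambda>j. column j (euclidean_gradient F X)"
  defines "c \<equiv> \<lambda>\<tau> j. 1 + \<tau>\<^sup>2 / 4 * (g j \<bullet> g j - (x j \<bullet> g j)\<^sup>2)"
  shows "column j (Y_curve F \<rho> X \<tau>)
    = ((2 + \<tau> * (x j \<bullet> g j)) / c \<tau> j - 1) *\<^sub>R x j - (\<tau> / c \<tau> j) *\<^sub>R g j"
proof -
  let ?G = "euclidean_gradient F X"
  have univ: "(UNIV :: 'p set) = {j}"
    using p by (metis UNIV_I card_1_singletonE singletonD)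
  have all: "k = j" for k using univ by auto
  have gram: "(transpose A ** B) $ k $ l = column j A \<bullet> column j B" for A B :: "real^'p^'n" and k l
    using all[of k] all[of l] 
    by (simp add: matrix_matrix_mult_def transpose_def column_def inner_vec_def)
  have scalar: "A = (A $ j $ j) *\<^sub>R mat 1" for A :: "real^'p^'p"
    using all by (simp add: vec_eq_iff mat_def) (metis)
  have xx: "x j \<bullet> x j = 1"
    using gram[of X X j j] X by (simp add: x_def mat_def)
  \<comment> \<open>A 1 by 1 matrix is symmetric; being skew-symmetric too, it vanishes.\<close>
  have "transpose (transpose X ** D_mat F \<rho> X) = transpose X ** D_mat F \<rho> X"
    by (subst (1 2) scalar) (simp add: transpose_linear_simps)
  then have XD: "transpose X ** D_mat F \<rho> X = 0"
    using D_mat_skew[of \<rho>]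
    by (metis add_eq_0_iff2 scaleR_2 scaleR_eq_0_iff zero_neq_numeral)
  have W: "column j (W_mat F \<rho> X) = (x j \<bullet> g j) *\<^sub>R x j - g j"
    by (simp add: W_mat_eq column_def x_def g_def vec_eq_iff matrix_matrix_mult_def[of X] univ
        gram mult.commute)
  have c: "J_mat F \<rho> X \<tau> $ j $ j = c \<tau> j"
    by (simp add: J_mat_def XD gram W mat_def c_def inner_diff_left inner_diff_right xx
        inner_commute[of "g j" "x j"] power2_eq_square)
  \<comment> \<open>The squared norm of \<open>W\<close> is g \<bullet> g -
    \<open>(x j \<bullet> g j)\<^sup>2\<close>, hence \<open>c \<tau> j\<close> is at least 1 and
    may be inverted.\<close>
  have "0 \<le> column j (W_mat F \<rho> X) \<bullet> column j (W_mat F \<rho> X)"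
    by simp
  then have "0 \<le> g j \<bullet> g j - (x j \<bullet> g j)\<^sup>2"
    by (simp add: W inner_diff_left inner_diff_right xx inner_commute[of "g j" "x j"] power2_eq_square)
  then have "c \<tau> j > 0"
    unfolding c_def by (intro add_pos_nonneg mult_nonneg_nonneg) auto
  then have "J_mat F \<rho> X \<tau> ** ((1 / c \<tau> j) *\<^sub>R mat 1) = mat 1"
    by (subst scalar) (simp add: c matrix_mult_bilinear_simps)
  then have "matrix_inv (J_mat F \<rho> X \<tau>) = (1 / c \<tau> j) *\<^sub>R mat 1"
    by (rule matrix_inv_unique)
  then have "Y_curve F \<rho> X \<tau> = (1 / c \<tau> j) *\<^sub>R (2 *\<^sub>R X + \<tau> *\<^sub>R W_mat F \<rho> X) - X"
    unfolding Y_curve_def by (simp add: matrix_mult_bilinear_simps algebra_simps)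
  then have "column j (Y_curve F \<rho> X \<tau>)
      = (1 / c \<tau> j) *\<^sub>R (2 *\<^sub>R x j + \<tau> *\<^sub>R column j (W_mat F \<rho> X)) - x j"
    by (simp add: column_def x_def vec_eq_iff)
  then show ?thesis
    by (simp only: W scaleR_add_right scaleR_diff_right scaleR_diff_left scaleR_add_left
        add_divide_distrib scaleR_scaleR scaleR_one) simp
qed

end

theorem lemma3p1:
  fixes F :: "real^'p^'n \<Rightarrow> real" and X :: "real^'p^'n" and \<rho> :: real
  assumes "CARD('p) \<le> CARD('n)"
    and "\<forall>Z. F differentiable (at Z)"
    and "transpose X ** X = mat 1"
    and "\<rho> > 0"
  shows
    "let G = euclidean_gradient F X;
         N = stiefel_gradient F X;
         D = D_mat F \<rho> X;
         W = W_mat F \<rho> X;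
         J = J_mat F \<rho> X;
         Y = Y_curve F \<rho> X
     in
       D = G - X ** ((2 * \<rho>) *\<^sub>R (transpose G ** X) + (1 - 2 * \<rho>) *\<^sub>R (transpose X ** G))
     \<and> (\<forall>\<tau>\<ge>0. invertible (J \<tau>))
     \<and> (\<forall>\<tau>\<ge>0. transpose (Y \<tau>) ** Y \<tau> = mat 1)
     \<and> (Y has_vector_derivative - D) (at 0)
     \<and> (N \<noteq> 0 \<longrightarrow> descent_direction F X (- D))
     \<and> (\<lambda>\<tau>. F (Y \<tau>)) differentiable (at 0)
     \<and> deriv (\<lambda>\<tau>. F (Y \<tau>)) 0 \<le> - (min \<rho> 1 * (norm N)\<^sup>2)
     \<and> (W \<noteq> 0 \<longrightarrow> (\<forall>\<tau>>0. \<forall>Q :: real^'p^'p. orthogonal_matrix Q \<longrightarrow> Y \<tau> ** Q \<noteq> X))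
     \<and> (\<forall>\<tau>\<ge>0. cond_number (J \<tau>) \<le> (5 + (\<tau> * norm D)\<^sup>2) / 4)
     \<and> (CARD('p) = CARD('n) \<longrightarrow>
          (\<forall>\<tau>\<ge>0. Y \<tau> = X ** (2 *\<^sub>R matrix_inv (J \<tau>) - mat 1)
               \<and> J \<tau> = mat 1 + (\<tau> / 2) *\<^sub>R (transpose X ** D)))
     \<and> (CARD('p) = 1 \<longrightarrow>
          (\<forall>\<tau>\<ge>0. \<forall>j. let x = column j X; g = column j G; y = column j (Y \<tau>);
                            c = 1 + \<tau>\<^sup>2 / 4 * (g \<bullet> g - (x \<bullet> g)\<^sup>2)
                        in y = ((2 + \<tau> * (x \<bullet> g)) / c - 1) *\<^sub>R x - (\<tau> / c) *\<^sub>R g))"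
proof -
  note X = assms(3)
  have skew: "transpose (transpose X ** D_mat F \<rho> X) = - (transpose X ** D_mat F \<rho> X)"
    by (rule D_mat_skew[OF X])
  have deriv: "((\<lambda>\<tau>. F (Y_curve F \<rho> X \<tau>)) has_real_derivative
      - (euclidean_gradient F X \<bullet> D_mat F \<rho> X)) (at 0)"
    using has_derivative_along[OF _ Y_curve_derivative[OF X]] assms(2)
    by (simp add: Y_curve_0[OF X])
  have square: "Y_curve F \<rho> X \<tau> = X ** (2 *\<^sub>R matrix_inv (J_mat F \<rho> X \<tau>) - mat 1)
      \<and> J_mat F \<rho> X \<tau> = mat 1 + (\<tau> / 2) *\<^sub>R (transpose X ** D_mat F \<rho> X)"
    if "CARD('p) = CARD('n)" for \<tau>
  proof -
    have "W_mat F \<rho> X = 0" by (rule W_mat_square[OF X that])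
    then show ?thesis
      by (simp add: Y_curve_def J_mat_def matrix_mult_bilinear_simps)
  qed
  show ?thesis
    unfolding Let_def
  proof (intro conjI impI allI)
    show "invertible (J_mat F \<rho> X \<tau>)" for \<tau>
      unfolding J_mat_eq[OF X] by (rule invertible_curve_J[OF skew])
    show "transpose (Y_curve F \<rho> X \<tau>) ** Y_curve F \<rho> X \<tau> = mat 1" for \<tau>
      unfolding Y_curve_eq[OF X] by (rule curve_Y_orthonormal[OF X transpose_mult_W_mat[OF X] skew])
    show "(\<lambda>\<tau>. F (Y_curve F \<rho> X \<tau>)) differentiable (at 0)"
      using deriv real_differentiable_def by blast
    show "deriv (\<lambda>\<tau>. F (Y_curve F \<rho> X \<tau>)) 0 \<le> - (min \<rho> 1 * (norm (stiefel_gradient F X))\<^sup>2)"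
      unfolding DERIV_imp_deriv[OF deriv] using inner_gradient_D_mat_ge[OF X] by simp
    show "Y_curve F \<rho> X \<tau> ** Q \<noteq> X"
      if "W_mat F \<rho> X \<noteq> 0" "0 < \<tau>" "orthogonal_matrix Q" for \<tau> and Q :: "real^'p^'p"
      using curve_Y_orbit[OF X transpose_mult_W_mat[OF X] skew that(3), of \<tau>] that(1,2)
      unfolding Y_curve_eq[OF X] by auto
    show "D_mat F \<rho> X = euclidean_gradient F X
        - X ** ((2 * \<rho>) *\<^sub>R (transpose (euclidean_gradient F X) ** X)
              + (1 - 2 * \<rho>) *\<^sub>R (transpose X ** euclidean_gradient F X))"
      by (rule D_mat_eq[OF X])
    show "(Y_curve F \<rho> X has_vector_derivative - D_mat F \<rho> X) (at 0)"
      by (rule Y_curve_derivative[OF X])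
    show "descent_direction F X (- D_mat F \<rho> X)" if "stiefel_gradient F X \<noteq> 0"
      using descent_direction_D_mat[OF X] assms(2,4) that by blast
    show "cond_number (J_mat F \<rho> X \<tau>) \<le> (5 + (\<tau> * norm (D_mat F \<rho> X))\<^sup>2) / 4" for \<tau>
      by (rule cond_number_J_mat_le[OF X])
  qed (use square in blast, use square in blast, rule Y_curve_vector[OF X])
qed

end
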